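(* Let $f\in\mathfrak{A}$ be a coupling structure with frame $H$, $V=V(H)$. If $s_H(A)\in C_f+I_f+Q_V$ for some $A\subseteq V$, then the graph $(A,E(A))$ satisfies Sidorenko's conjecture.
   Context: Graphs are finite and simple; $\mathrm{Hom}(H,G)$ is the set of homomorphisms $V(H)\to V(G)$; $t(H,G)$ is the probability that a uniformly random map $V(H)\to V(G)$ is a homomorphism; $e$ is the one-edge graph on $\{1,2\}$ and $\tau(e,G)$ the uniform distribution on $\mathrm{Hom}(e,G)$. A graph $F$ satisfies Sidorenko's conjecture if $t(F,G)\ge t(e,G)^{|E(F)|}$ for all finite graphs $G$. Probability schemes: a scheme with frame $H$ assigns to each finite graph $G$ with nonempty edge set a distribution $f(G)$ on $\mathrm{Hom}(H,G)$. For injective $\beta:S\to V(H)$, $f|_\beta(G)$ is the push-forward of $f(G)$ under $\varphi\mapsto\varphi\circ\beta$. Given schemes $f_1,f_2$ with frames $H_1,H_2$ and injective $\beta_i:[n]\to V(H_i)$ with $f_1(G)|_{\beta_1}=f_2(G)|_{\beta_2}=:\mu_3(G)$ for all $G$, the coupling $C(f_1,f_2,\beta_1,\beta_2)$ has frame obtained from the disjoint union of $H_1,H_2$ by identifying $\beta_1(j)$ with $\beta_2(j)$ (multiple edges deleted), and gives $\varphi$ (restrictions $\varphi_1,\varphi_2$) probability $f_1(G)(\varphi_1)f_2(G)(\varphi_2)/\mu_3(G)(\varphi_1\circ\beta_1)$ (or $0$ if the denominator is $0$). $\mathfrak{A}$ (coupling structures) is the smallest set of schemes containing $G\mapsto\tau(e,G)$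 and closed under these couplings. Set functions: in $\mathbb{R}^{2^V}$, $1_S$ is the function equal to $1$ at the subset $S$ and $0$ at all other subsets; $t_{A,B}=1_{A\cup B}-1_A-1_B+1_{A\cap B}$; for a relation $b\subseteq 2^V\times 2^V$, $W_b$ is the linear span of $\{t_{A,B}:(A,B)\in b\}$; $Q_V$ is the sum of the line $\mathbb{R}1_\emptyset$ and the cone of nonnegative combinations of all $t_{A,B}$ and all $1_A$ ($A,B\subseteq V$). $s_H(A)=-1_A+\sum_{e\in E(A)}1_e$, where $E(A)$ is the set of edges of $H$ contained in $A$. For $A\subseteq V$, $f_A$ is the restriction of $f$ to the coordinates in $A$. $CI(f)$ is the set of pairs $(A,B)$ of subsets of $V$ such that for every $G$ the marginal $f_{A\cup B}(G)$ is the conditionally independent coupling of $f_A(G)$ and $f_B(G)$ over $f_{A\cap B}(G)$; $C_f=W_{CI(f)}$. $IS(f)$ is the set of pairs $(A,B)$ for which there is a bijection $\beta:A\to B$ with $f_A=f|_\beta$; $I_f$ is the linear span of $\{1_A-1_B:(A,B)\in IS(f)\}$. *)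

theory Defs
  imports "HOL-Probability.Probability" "HOL-Analysis.Finite_Function_Topology"
begin

section \<open>Graphs, homomorphisms and Sidorenko's conjecture\<close>

text \<open>Graphs have natural numbers as vertices; every finite graph is isomorphic to such a graph.\<close>

record sgraph =
  verts :: "nat set"
  edges :: "nat set set"

definition finite_simple :: "sgraph \<Rightarrow> bool" where
  "finite_simple G \<longleftrightarrow> finite (verts G) \<and> (\<forall>e\<in>edges G. e \<subseteq> verts G \<and> card e = 2)"

text \<open>Homomorphisms are extensional functions, so that they are determined by their values on
  the vertices of the source.\<close>

definition Hom :: "sgraph \<Rightarrow> sgraph \<Rightarrow> (nat \<Rightarrow> nat) set" where
  "Hom H G = {\<phi> \<in> verts H \<rightarrow>\<^sub>E verts G. \<forall>e\<in>edges H. \<phi> ` e \<in> edges G}"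

definition edge_graph :: sgraph where
  "edge_graph = \<lparr>verts = {1, 2}, edges = {{1, 2}}\<rparr>"

definition hom_density :: "sgraph \<Rightarrow> sgraph \<Rightarrow> real" where
  "hom_density H G = measure_pmf.prob (pmf_of_set (verts H \<rightarrow>\<^sub>E verts G)) (Hom H G)"

text \<open>The target must have a vertex, since otherwise there need not be any map into it and the
  densities are undefined.\<close>

definition sidorenko :: "sgraph \<Rightarrow> bool" where
  "sidorenko F \<longleftrightarrow>
    (\<forall>G. finite_simple G \<and> verts G \<noteq> {} \<longrightarrow>
      hom_density F G \<ge> hom_density edge_graph G ^ card (edges F))"

definition edges_in :: "sgraph \<Rightarrow> nat set \<Rightarrow> nat set set" where
  "edges_in H A = {e \<in> edges H. e \<subseteq> A}"

definition induced :: "sgraph \<Rightarrow> nat set \<Rightarrow> sgraph" where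
  "induced H A = \<lparr>verts = A, edges = edges_in H A\<rparr>"


section \<open>Probability schemes and coupling structures\<close>

text \<open>A scheme is only meaningful on the following targets; its values elsewhere are junk and
  are never inspected.\<close>

definition target :: "sgraph \<Rightarrow> bool" where
  "target G \<longleftrightarrow> finite_simple G \<and> edges G \<noteq> {}"

type_synonym scheme = "sgraph \<Rightarrow> (nat \<Rightarrow> nat) pmf"

definition is_scheme :: "sgraph \<Rightarrow> scheme \<Rightarrow> bool" where
  "is_scheme H f \<longleftrightarrow> finite_simple H \<and> (\<forall>G. target G \<longrightarrow> set_pmf (f G) \<subseteq> Hom H G)"

text \<open>\<open>pull S \<beta> f\<close> is $f|_\beta$ for $\beta : S \to V(H)$, and \<open>marginal A f\<close> is $f_A$.\<close>

definition pull :: "nat set \<Rightarrow> (nat \<Rightarrow> nat) \<Rightarrow> scheme \<Rightarrow> scheme" where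
  "pull S \<beta> f G = map_pmf (\<lambda>\<phi>. restrict (\<phi> \<circ> \<beta>) S) (f G)"

definition marginal :: "nat set \<Rightarrow> scheme \<Rightarrow> scheme" where
  "marginal A f = pull A id f"

text \<open>\<open>H\<close>, with the embeddings \<open>\<iota>1\<close> and \<open>\<iota>2\<close>, is the disjoint union of \<open>H1\<close> and \<open>H2\<close> with
  \<open>\<beta>1 j\<close> and \<open>\<beta>2 j\<close> identified for \<open>j \<in> {1..n}\<close>. The names of the glued vertices are left open,
  so this characterises the frame up to isomorphism.\<close>

definition is_gluing ::
  "sgraph \<Rightarrow> sgraph \<Rightarrow> nat \<Rightarrow> (nat \<Rightarrow> nat) \<Rightarrow> (nat \<Rightarrow> nat) \<Rightarrow>
   sgraph \<Rightarrow> (nat \<Rightarrow> nat) \<Rightarrow> (nat \<Rightarrow> nat) \<Rightarrow> bool" where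
  "is_gluing H1 H2 n \<beta>1 \<beta>2 H \<iota>1 \<iota>2 \<longleftrightarrow>
     inj_on \<iota>1 (verts H1) \<and> inj_on \<iota>2 (verts H2) \<and>
     (\<forall>j\<in>{1..n}. \<iota>1 (\<beta>1 j) = \<iota>2 (\<beta>2 j)) \<and>
     \<iota>1 ` verts H1 \<inter> \<iota>2 ` verts H2 = (\<iota>1 \<circ> \<beta>1) ` {1..n} \<and>
     verts H = \<iota>1 ` verts H1 \<union> \<iota>2 ` verts H2 \<and>
     edges H = (\<lambda>e. \<iota>1 ` e) ` edges H1 \<union> (\<lambda>e. \<iota>2 ` e) ` edges H2"

text \<open>\<open>f\<close>, with frame \<open>H\<close>, is the coupling $C(f_1, f_2, \beta_1, \beta_2)$. The convention
  \<open>x / 0 = 0\<close> covers the case of a vanishing denominator.\<close>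

definition is_coupling ::
  "sgraph \<Rightarrow> scheme \<Rightarrow> sgraph \<Rightarrow> scheme \<Rightarrow> nat \<Rightarrow> (nat \<Rightarrow> nat) \<Rightarrow> (nat \<Rightarrow> nat) \<Rightarrow>
   sgraph \<Rightarrow> scheme \<Rightarrow> bool" where
  "is_coupling H1 f1 H2 f2 n \<beta>1 \<beta>2 H f \<longleftrightarrow>
     \<beta>1 \<in> {1..n} \<rightarrow> verts H1 \<and> inj_on \<beta>1 {1..n} \<and>
     \<beta>2 \<in> {1..n} \<rightarrow> verts H2 \<and> inj_on \<beta>2 {1..n} \<and>
     (\<forall>G. target G \<longrightarrow> pull {1..n} \<beta>1 f1 G = pull {1..n} \<beta>2 f2 G) \<and>
     is_scheme H f \<and>
     (\<exists>\<iota>1 \<iota>2. is_gluing H1 H2 n \<beta>1 \<beta>2 H \<iota>1 \<iota>2 \<and>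
       (\<forall>G. target G \<longrightarrow> (\<forall>\<phi>\<in>Hom H G.
          (let \<phi>1 = restrict (\<phi> \<circ> \<iota>1) (verts H1);
               \<phi>2 = restrict (\<phi> \<circ> \<iota>2) (verts H2)
           in pmf (f G) \<phi> =
                pmf (f1 G) \<phi>1 * pmf (f2 G) \<phi>2
                  / pmf (pull {1..n} \<beta>1 f1 G) (restrict (\<phi>1 \<circ> \<beta>1) {1..n})))))"

text \<open>\<open>coupling_structure H f\<close> means that \<open>f\<close>, regarded as a scheme with frame \<open>H\<close>, is a member
  of $\mathfrak{A}$.\<close>

inductive coupling_structure :: "sgraph \<Rightarrow> scheme \<Rightarrow> bool" where
  edge: "coupling_structure edge_graph (\<lambda>G. pmf_of_set (Hom edge_graph G))"
| coupling: "coupling_structure H1 f1 \<Longrightarrow> coupling_structure H2 f2 \<Longrightarrow>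
    is_coupling H1 f1 H2 f2 n \<beta>1 \<beta>2 H f \<Longrightarrow> coupling_structure H f"


section \<open>Set functions\<close>

text \<open>$\mathbb{R}^{2^V}$ is rendered as the space of those finitely supported functions on sets
  whose support consists of subsets of the finite set \<open>V\<close>; all spaces below lie in it.\<close>

type_synonym setfun = "nat set \<Rightarrow>\<^sub>0 real"

definition unit_at :: "nat set \<Rightarrow> setfun" where
  "unit_at S = Poly_Mapping.single S 1"

definition t_vec :: "nat set \<Rightarrow> nat set \<Rightarrow> setfun" where
  "t_vec A B = unit_at (A \<union> B) - unit_at A - unit_at B + unit_at (A \<inter> B)"

definition W_space :: "(nat set \<times> nat set) set \<Rightarrow> setfun set" where
  "W_space b = span {t_vec A B |A B. (A, B) \<in> b}"

definition Q_set :: "nat set \<Rightarrow> setfun set" where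
  "Q_set V = span {unit_at {}} +
     convex_cone hull ({t_vec A B |A B. A \<subseteq> V \<and> B \<subseteq> V} \<union> {unit_at A |A. A \<subseteq> V})"

definition s_vec :: "sgraph \<Rightarrow> nat set \<Rightarrow> setfun" where
  "s_vec H A = - unit_at A + (\<Sum>e\<in>edges_in H A. unit_at e)"

definition CI :: "sgraph \<Rightarrow> scheme \<Rightarrow> (nat set \<times> nat set) set" where
  "CI H f = {(A, B). A \<subseteq> verts H \<and> B \<subseteq> verts H \<and>
     (\<forall>G. target G \<longrightarrow> (\<forall>\<phi> \<in> A \<union> B \<rightarrow>\<^sub>E verts G.
        pmf (marginal (A \<union> B) f G) \<phi> =
          pmf (marginal A f G) (restrict \<phi> A) * pmf (marginal B f G) (restrict \<phi> B)
            / pmf (marginal (A \<inter> B) f G) (restrict \<phi> (A \<inter> B))))}"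

definition C_space :: "sgraph \<Rightarrow> scheme \<Rightarrow> setfun set" where
  "C_space H f = W_space (CI H f)"

definition IS :: "sgraph \<Rightarrow> scheme \<Rightarrow> (nat set \<times> nat set) set" where
  "IS H f = {(A, B). A \<subseteq> verts H \<and> B \<subseteq> verts H \<and>
     (\<exists>\<beta>. bij_betw \<beta> A B \<and> (\<forall>G. target G \<longrightarrow> marginal A f G = pull A \<beta> f G))}"

definition I_space :: "sgraph \<Rightarrow> scheme \<Rightarrow> setfun set" where
  "I_space H f = span {unit_at A - unit_at B |A B. (A, B) \<in> IS H f}"

end

theory Submission
  imports Defs
begin

text \<open>For a target \<open>G\<close> with \<open>n\<close> vertices, let \<open>d S = |S| ln n - h S\<close>, where \<open>h S\<close> is the Shannon
  entropy of the marginal of \<open>f G\<close> on \<open>S\<close>, and extend \<open>d\<close> linearly to set functions. Submodularity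
  of entropy and the bound \<open>h S \<le> |S| ln n\<close> make this functional nonnegative on \<open>Q_set\<close>; it vanishes
  on \<open>C_space\<close>, because conditional independence is the equality case of submodularity, and on
  \<open>I_space\<close>. Couplings preserve the marginals of their two parts, so every edge marginal is uniform
  and \<open>d e = - ln t(e,G)\<close> for each edge \<open>e\<close>. Evaluating at \<open>s_vec H A\<close> yields
  \<open>|E(A)| (- ln t(e,G)) \<ge> d A \<ge> - ln t(H[A],G)\<close>, the last step because entropy is at most the
  logarithm of the size of the support.\<close>

section \<open>Entropy of finitely supported distributions\<close>

text \<open>Entropy in nats. In expectation form, the entropy of a push-forward becomes an
  expectation under the original distribution.\<close>

definition entropy_pmf :: "'a pmf \<Rightarrow> real" where
  "entropy_pmf p = - measure_pmf.expectation p (\<lambda>x. ln (pmf p x))"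

lemma entropy_map_pmf:
  "entropy_pmf (map_pmf h p) = - measure_pmf.expectation p (\<lambda>x. ln (pmf (map_pmf h p) (h x)))"
  by (simp add: entropy_pmf_def)

lemma entropy_map_pmf_inj:
  assumes "inj_on h (set_pmf p)"
  shows "entropy_pmf (map_pmf h p) = entropy_pmf p"
proof -
  have "measure_pmf.expectation p (\<lambda>x. ln (pmf (map_pmf h p) (h x)))
      = measure_pmf.expectation p (\<lambda>x. ln (pmf p x))"
    by (intro integral_cong_AE) (auto simp: AE_measure_pmf_iff pmf_map_inj[OF assms])
  then show ?thesis
    unfolding entropy_map_pmf by (simp add: entropy_pmf_def)
qed

text \<open>Nonnegativity of relative entropy: weight \<open>ln z \<le> z - 1\<close> at
  \<open>z = q x / pmf p x\<close> by \<open>pmf p x\<close> and sum. A total mass of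
  \<open>q\<close> below 1 only helps, so a sub-probability is enough.\<close>

lemma gibbs_inequality:
  fixes q :: "'a \<Rightarrow> real"
  assumes "finite (set_pmf p)" and pos: "\<And>x. x \<in> set_pmf p \<Longrightarrow> q x > 0"
    and le: "(\<Sum>x\<in>set_pmf p. q x) \<le> 1"
  shows "measure_pmf.expectation p (\<lambda>x. ln (q x)) \<le> - entropy_pmf p"
proof -
  let ?S = "set_pmf p"
  have "pmf p x * ln (q x) \<le> pmf p x * ln (pmf p x) + q x - pmf p x" if "x \<in> ?S" for x
  proof -
    have p: "pmf p x > 0" and q: "q x > 0"
      using that pos by (auto simp: pmf_positive)
    have "ln (q x / pmf p x) \<le> q x / pmf p x - 1"
      using p q by (intro ln_le_minus_one) simp
    then have "pmf p x * (ln (q x) - ln (pmf p x)) \<le> pmf p x * (q x / pmf p x - 1)"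
      using p q by (intro mult_left_mono) (simp_all add: ln_div)
    then show ?thesis
      using p by (simp add: algebra_simps)
  qed
  then have "(\<Sum>x\<in>?S. pmf p x * ln (q x)) \<le> (\<Sum>x\<in>?S. pmf p x * ln (pmf p x) + q x - pmf p x)"
    by (rule sum_mono)
  also have "\<dots> \<le> (\<Sum>x\<in>?S. pmf p x * ln (pmf p x))"
    using le assms(1) by (simp add: sum.distrib sum_subtractf sum_pmf_eq_1)
  finally show ?thesis
    unfolding entropy_pmf_def
    by (subst (1 2) integral_measure_pmf[of ?S]) (auto simp: assms(1))
qed

text \<open>Gibbs against the constant weight \<open>1 / card S\<close>, whose mass on the support
  of \<open>p\<close> is at most 1.\<close>

lemma entropy_le_ln_card:
  assumes "finite S" "set_pmf p \<subseteq> S"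
  shows "entropy_pmf p \<le> ln (real (card S))"
proof -
  have fin: "finite (set_pmf p)"
    using assms finite_subset by blast
  have "S \<noteq> {}"
    using assms set_pmf_not_empty[of p] by blast
  then have card: "card S > 0"
    using assms by (simp add: card_gt_0_iff)
  have "real (card (set_pmf p)) \<le> real (card S)"
    using assms by (simp add: card_mono)
  then have "measure_pmf.expectation p (\<lambda>x. ln (1 / real (card S))) \<le> - entropy_pmf p"
    using card fin by (intro gibbs_inequality) (auto simp: field_simps)
  then show ?thesis
    using card by (simp add: ln_div)
qed

lemma entropy_pmf_of_set:
  assumes "finite S" "S \<noteq> {}"
  shows "entropy_pmf (pmf_of_set S) = ln (real (card S))"
  using assms
  by (simp add: entropy_pmf_def integral_pmf_of_set ln_div card_gt_0_iff)

section \<open>Couplings\<close>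

text \<open>Think of \<open>r1\<close>, \<open>r2\<close> as restrictions to two parts and of
  \<open>c1\<close>, \<open>c2\<close> as restrictions of the parts to their overlap. Where
  \<open>r1 x = u\<close>, the values \<open>r2 x\<close> are distinct and lie over the overlap
  value \<open>c1 u\<close>, so their \<open>p2\<close>-mass is at most the denominator, which
  cancels it.\<close>

lemma coupling_fibre_sum_le:
  assumes fin: "finite S" and inj: "inj_on (\<lambda>x. (r1 x, r2 x)) S"
    and compat: "\<And>x. x \<in> S \<Longrightarrow> c1 (r1 x) = c2 (r2 x)"
    and eq: "map_pmf c1 p1 = map_pmf c2 p2"
  shows "(\<Sum>x\<in>{x\<in>S. r1 x = u}. pmf p1 (r1 x) * pmf p2 (r2 x) / pmf (map_pmf c1 p1) (c1 (r1 x)))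
    \<le> pmf p1 u"
proof -
  let ?F = "{x\<in>S. r1 x = u}" and ?m = "pmf (map_pmf c1 p1) (c1 u)"
  have "(\<Sum>x\<in>?F. pmf p2 (r2 x)) = (\<Sum>v\<in>r2 ` ?F. pmf p2 v)"
    using inj by (subst sum.reindex) (auto simp: inj_on_def)
  also have "\<dots> = measure_pmf.prob p2 (r2 ` ?F)"
    using fin by (simp add: measure_measure_pmf_finite)
  also have "\<dots> \<le> measure_pmf.prob p2 (c2 -` {c1 u})"
    using compat by (intro measure_pmf.finite_measure_mono) auto
  also have "\<dots> = ?m"
    by (simp add: eq pmf_map)
  finally have le: "(\<Sum>x\<in>?F. pmf p2 (r2 x)) \<le> ?m" .
  have "(\<Sum>x\<in>?F. pmf p1 (r1 x) * pmf p2 (r2 x) / pmf (map_pmf c1 p1) (c1 (r1 x)))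
      = pmf p1 u * ((\<Sum>x\<in>?F. pmf p2 (r2 x)) / ?m)"
    by (simp add: sum_distrib_left sum_divide_distrib)
  \<comment> \<open>If \<open>?m\<close> vanishes, the quotient is 0 by \<open>x / 0 = 0\<close>,
    and the bound still holds.\<close>
  also have "\<dots> \<le> pmf p1 u * 1"
    using le by (intro mult_left_mono) (auto simp: divide_le_eq_1 less_le)
  finally show ?thesis by simp
qed

text \<open>A pmf that is pointwise dominated by another one equals it, so surjectivity of \<open>(r1, r2)\<close> onto
  the compatible pairs need not be checked.\<close>

lemma map_pmf_coupling_eq:
  assumes "finite S" "set_pmf p \<subseteq> S" and "inj_on (\<lambda>x. (r1 x, r2 x)) S"
    and "\<And>x. x \<in> S \<Longrightarrow> c1 (r1 x) = c2 (r2 x)"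
    and "map_pmf c1 p1 = map_pmf c2 p2"
    and pmf: "\<And>x. x \<in> S \<Longrightarrow>
      pmf p x = pmf p1 (r1 x) * pmf p2 (r2 x) / pmf (map_pmf c1 p1) (c1 (r1 x))"
  shows "map_pmf r1 p = p1"
proof (rule ccontr)
  assume "map_pmf r1 p \<noteq> p1"
  then obtain u where u: "pmf p1 u < pmf (map_pmf r1 p) u"
    using pmf_neq_exists_less[of p1 "map_pmf r1 p"] by auto
  have "pmf (map_pmf r1 p) u = measure_pmf.prob p (r1 -` {u})"
    by (simp add: pmf_map)
  also have "\<dots> = measure_pmf.prob p {x\<in>S. r1 x = u}"
    using assms(2) by (intro measure_prob_cong_0) (auto simp: set_pmf_iff)
  also have "\<dots> = (\<Sum>x\<in>{x\<in>S. r1 x = u}. pmf p x)"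
    using assms(1) by (simp add: measure_measure_pmf_finite)
  also have "\<dots> = (\<Sum>x\<in>{x\<in>S. r1 x = u}.
      pmf p1 (r1 x) * pmf p2 (r2 x) / pmf (map_pmf c1 p1) (c1 (r1 x)))"
    by (rule sum.cong) (auto simp: pmf)
  also have "\<dots> \<le> pmf p1 u"
    by (rule coupling_fibre_sum_le) (use assms in auto)
  finally show False using u by simp
qed

section \<open>Submodularity of entropy and its equality case\<close>

lemma sum_coupling_le_1:
  assumes fin: "finite S" and "inj_on (\<lambda>x. (r1 x, r2 x)) S"
    and "\<And>x. x \<in> S \<Longrightarrow> c1 (r1 x) = c2 (r2 x)"
    and "map_pmf c1 p1 = map_pmf c2 p2"
  shows "(\<Sum>x\<in>S. pmf p1 (r1 x) * pmf p2 (r2 x) / pmf (map_pmf c1 p1) (c1 (r1 x))) \<le> 1"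
    (is "sum ?g S \<le> 1")
proof -
  \<comment> \<open>Fibre by fibre over \<open>r1\<close>, the coupling weights are bounded by
    \<open>p1\<close>, whose total mass is 1.\<close>
  have "sum ?g S = (\<Sum>u\<in>r1 ` S. sum ?g {x\<in>S. r1 x = u})"
    using fin by (rule sum.image_gen)
  also have "\<dots> \<le> (\<Sum>u\<in>r1 ` S. pmf p1 u)"
    by (intro sum_mono coupling_fibre_sum_le) (use assms in auto)
  also have "\<dots> = measure_pmf.prob p1 (r1 ` S)"
    using fin by (simp add: measure_measure_pmf_finite)
  finally show ?thesis
    using measure_pmf.prob_le_1[of p1 "r1 ` S"] by linarith
qed

text \<open>On the support of \<open>p\<close> all three marginals are positive, so the logarithm
  splits, and each summand integrates to an entropy up to sign. Both the inequality and its equality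
  case rest on this.\<close>

lemma expectation_ln_coupling:
  assumes "finite (set_pmf p)"
  shows "measure_pmf.expectation p (\<lambda>x. ln (pmf (map_pmf a p) (a x) * pmf (map_pmf b p) (b x)
      / pmf (map_pmf c p) (c x)))
    = entropy_pmf (map_pmf c p) - entropy_pmf (map_pmf a p) - entropy_pmf (map_pmf b p)"
    (is "measure_pmf.expectation p ?l = _")
proof -
  have "measure_pmf.expectation p ?l = measure_pmf.expectation p (\<lambda>x. ln (pmf (map_pmf a p) (a x))
      + ln (pmf (map_pmf b p) (b x)) - ln (pmf (map_pmf c p) (c x)))"
  proof (intro integral_cong_AE)
    show "AE x in p. ?l x = ln (pmf (map_pmf a p) (a x))
      + ln (pmf (map_pmf b p) (b x)) - ln (pmf (map_pmf c p) (c x))"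
      unfolding AE_measure_pmf_iff
    proof
      fix x assume x: "x \<in> set_pmf p"
      have "pmf (map_pmf a p) (a x) > 0" "pmf (map_pmf b p) (b x) > 0" "pmf (map_pmf c p) (c x) > 0"
        using x by (auto intro!: pmf_positive)
      then show "?l x = ln (pmf (map_pmf a p) (a x))
        + ln (pmf (map_pmf b p) (b x)) - ln (pmf (map_pmf c p) (c x))"
        by (simp add: ln_div ln_mult)
    qed
  qed auto
  then show ?thesis
    using assms by (simp add: entropy_map_pmf integrable_measure_pmf_finite)
qed

text \<open>Gibbs with \<open>q\<close> the conditionally independent coupling of the
  \<open>a\<close>- and \<open>b\<close>-marginals over the \<open>c\<close>-marginal.\<close>

lemma entropy_submodular:
  assumes fin: "finite (set_pmf p)" and inj: "inj_on (\<lambda>x. (a x, b x)) (set_pmf p)"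
    and c1: "\<And>x. c1 (a x) = c x" and c2: "\<And>x. c2 (b x) = c x"
  shows "entropy_pmf p + entropy_pmf (map_pmf c p)
    \<le> entropy_pmf (map_pmf a p) + entropy_pmf (map_pmf b p)"
proof -
  have m: "map_pmf c1 (map_pmf a p) = map_pmf c p" "map_pmf c2 (map_pmf b p) = map_pmf c p"
    by (simp_all add: map_pmf_comp c1 c2)
  let ?q = "\<lambda>x. pmf (map_pmf a p) (a x) * pmf (map_pmf b p) (b x) / pmf (map_pmf c p) (c x)"
  have "sum ?q (set_pmf p) \<le> 1"
    using sum_coupling_le_1[OF fin inj, of c1 c2 "map_pmf a p" "map_pmf b p"]
    by (simp add: m c1 c2)
  moreover have "?q x > 0" if "x \<in> set_pmf p" for x
    using that by (intro divide_pos_pos mult_pos_pos) (auto intro!: pmf_positive)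
  ultimately have "measure_pmf.expectation p (\<lambda>x. ln (?q x)) \<le> - entropy_pmf p"
    by (intro gibbs_inequality fin) auto
  then show ?thesis
    unfolding expectation_ln_coupling[OF fin] by simp
qed

text \<open>If \<open>p\<close> is itself that coupling, then the expectation of \<open>ln q\<close>
  in the Gibbs argument is exactly minus the entropy of \<open>p\<close>.\<close>

lemma entropy_modular:
  assumes fin: "finite (set_pmf p)"
    and q: "\<And>x. x \<in> set_pmf p \<Longrightarrow>
      pmf p x = pmf (map_pmf a p) (a x) * pmf (map_pmf b p) (b x) / pmf (map_pmf c p) (c x)"
  shows "entropy_pmf p + entropy_pmf (map_pmf c p)
    = entropy_pmf (map_pmf a p) + entropy_pmf (map_pmf b p)"
proof -
  have "entropy_pmf p = - measure_pmf.expectation p (\<lambda>x. ln (pmf (map_pmf a p) (a x)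
      * pmf (map_pmf b p) (b x) / pmf (map_pmf c p) (c x)))"
    unfolding entropy_pmf_def
    by (intro arg_cong[where f = uminus] integral_cong_AE) (auto simp: AE_measure_pmf_iff q[symmetric])
  then show ?thesis
    unfolding expectation_ln_coupling[OF fin] by simp
qed

section \<open>Marginals of schemes\<close>

lemma pull_pull:
  assumes "g G = pull T \<iota> f G" "\<beta> ` S \<subseteq> T"
  shows "pull S \<beta> g G = pull S (\<iota> \<circ> \<beta>) f G"
  unfolding pull_def assms(1) map_pmf_comp
  using assms(2) by (intro map_pmf_cong refl ext) (auto simp: restrict_def)

lemma marginal_marginal:
  "S \<subseteq> T \<Longrightarrow> marginal S f G = map_pmf (\<lambda>\<phi>. restrict \<phi> S) (marginal T f G)"
  unfolding marginal_def pull_def map_pmf_comp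
  by (intro map_pmf_cong refl ext) (auto simp: restrict_def)

lemma set_marginal_extensional: "\<phi> \<in> set_pmf (marginal S f G) \<Longrightarrow> \<phi> \<in> extensional S"
  by (auto simp: marginal_def pull_def)

lemma entropy_pull: "entropy_pmf (pull S \<beta> f G) = entropy_pmf (marginal (\<beta> ` S) f G)"
proof -
  have "pull S \<beta> f G = map_pmf (\<lambda>\<psi>. restrict (\<psi> \<circ> \<beta>) S) (marginal (\<beta> ` S) f G)"
    unfolding marginal_def pull_def map_pmf_comp
    by (intro map_pmf_cong refl ext) (auto simp: restrict_def)
  moreover have "inj_on (\<lambda>\<psi>. restrict (\<psi> \<circ> \<beta>) S) (set_pmf (marginal (\<beta> ` S) f G))"
  proof (rule inj_onI)
    fix \<phi> \<psi>
    assume "\<phi> \<in> set_pmf (marginal (\<beta> ` S) f G)" "\<psi> \<in> set_pmf (marginal (\<beta> ` S) f G)"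
      and eq: "restrict (\<phi> \<circ> \<beta>) S = restrict (\<psi> \<circ> \<beta>) S"
    then show "\<phi> = \<psi>"
    proof (intro extensionalityI[of _ "\<beta> ` S"])
      fix y assume "y \<in> \<beta> ` S"
      then obtain x where "x \<in> S" "y = \<beta> x" by blast
      then show "\<phi> y = \<psi> y"
        using fun_cong[OF eq, of x] by simp
    qed (auto dest: set_marginal_extensional)
  qed
  ultimately show ?thesis
    by (simp add: entropy_map_pmf_inj)
qed

lemma finite_Hom: "finite (verts H) \<Longrightarrow> finite (verts G) \<Longrightarrow> finite (Hom H G)"
  by (simp add: Hom_def finite_PiE)

lemma is_scheme_finite_set_pmf:
  assumes "is_scheme H f" "target G"
  shows "finite (set_pmf (f G))"
proof (rule finite_subset)
  show "set_pmf (f G) \<subseteq> Hom H G"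
    using assms by (simp add: is_scheme_def)
  show "finite (Hom H G)"
    using assms by (intro finite_Hom) (auto simp: is_scheme_def target_def finite_simple_def)
qed

text \<open>Identifies the support whose cardinality bounds the entropy at the end: the marginal on
  \<open>A\<close> lives on homomorphisms of the induced graph.\<close>

lemma set_marginal_subset_Hom:
  assumes "is_scheme H f" "target G" "S \<subseteq> verts H"
  shows "set_pmf (marginal S f G) \<subseteq> Hom (induced H S) G"
proof -
  have "restrict \<phi> S \<in> Hom (induced H S) G" if "\<phi> \<in> Hom H G" for \<phi>
  proof -
    have "restrict \<phi> S ` e = \<phi> ` e" if "e \<subseteq> S" for e
      using that by (intro image_cong) auto
    then show ?thesis
      using that assms(3) by (auto simp: Hom_def induced_def edges_in_def PiE_iff)
  qed
  then show ?thesis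
    using assms(1,2) by (auto simp: is_scheme_def marginal_def pull_def)
qed

section \<open>Edge marginals of coupling structures\<close>

lemma Hom_edge_graph_nonempty:
  assumes "target G"
  shows "Hom edge_graph G \<noteq> {}"
proof -
  from assms obtain e where e: "e \<in> edges G" and "e \<subseteq> verts G" "card e = 2"
    by (auto simp: target_def finite_simple_def)
  then obtain x y where xy: "e = {x, y}" "x \<in> verts G" "y \<in> verts G"
    by (auto simp: card_2_iff)
  have "(\<lambda>i\<in>{1, 2}. if i = 1 then x else y) \<in> Hom edge_graph G"
    using e xy by (auto simp: Hom_def edge_graph_def)
  then show ?thesis by blast
qed

lemma finite_Hom_edge_graph: "target G \<Longrightarrow> finite (Hom edge_graph G)"
  by (intro finite_Hom) (auto simp: edge_graph_def target_def finite_simple_def)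

lemma is_scheme_edge_graph: "is_scheme edge_graph (\<lambda>G. pmf_of_set (Hom edge_graph G))"
  unfolding is_scheme_def
  by (auto simp: set_pmf_of_set Hom_edge_graph_nonempty finite_Hom_edge_graph)
    (auto simp: edge_graph_def finite_simple_def)

lemma coupling_structure_is_scheme: "coupling_structure H f \<Longrightarrow> is_scheme H f"
  by (induction rule: coupling_structure.induct) (auto simp: is_scheme_edge_graph is_coupling_def)

text \<open>A coupling is specified by its point probabilities only; this recovers its two
  marginals, by applying \<open>map_pmf_coupling_eq\<close> on \<open>Hom H G\<close> once for each
  part.\<close>

lemma is_coupling_pull:
  assumes s1: "is_scheme H1 f1" and s2: "is_scheme H2 f2"
    and c: "is_coupling H1 f1 H2 f2 n \<beta>1 \<beta>2 H f"
  obtains \<iota>1 \<iota>2 where "is_gluing H1 H2 n \<beta>1 \<beta>2 H \<iota>1 \<iota>2"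
    and "\<And>G. target G \<Longrightarrow> pull (verts H1) \<iota>1 f G = f1 G"
    and "\<And>G. target G \<Longrightarrow> pull (verts H2) \<iota>2 f G = f2 G"
proof -
  from c obtain \<iota>1 \<iota>2 where g: "is_gluing H1 H2 n \<beta>1 \<beta>2 H \<iota>1 \<iota>2"
    and pmf: "\<And>G \<phi>. target G \<Longrightarrow> \<phi> \<in> Hom H G \<Longrightarrow>
      pmf (f G) \<phi> = pmf (f1 G) (restrict (\<phi> \<circ> \<iota>1) (verts H1)) *
        pmf (f2 G) (restrict (\<phi> \<circ> \<iota>2) (verts H2)) /
        pmf (pull {1..n} \<beta>1 f1 G) (restrict (restrict (\<phi> \<circ> \<iota>1) (verts H1) \<circ> \<beta>1) {1..n})"
    unfolding is_coupling_def Let_def by blast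
  have \<beta>: "\<beta>1 \<in> {1..n} \<rightarrow> verts H1" "\<beta>2 \<in> {1..n} \<rightarrow> verts H2"
    and s: "is_scheme H f"
    and eq: "\<And>G. target G \<Longrightarrow> pull {1..n} \<beta>1 f1 G = pull {1..n} \<beta>2 f2 G"
    using c by (auto simp: is_coupling_def)
  let ?r1 = "\<lambda>\<phi>. restrict (\<phi> \<circ> \<iota>1) (verts H1) :: nat \<Rightarrow> nat"
    and ?r2 = "\<lambda>\<phi>. restrict (\<phi> \<circ> \<iota>2) (verts H2) :: nat \<Rightarrow> nat"
    and ?c1 = "\<lambda>\<phi>. restrict (\<phi> \<circ> \<beta>1) {1..n} :: nat \<Rightarrow> nat"
    and ?c2 = "\<lambda>\<phi>. restrict (\<phi> \<circ> \<beta>2) {1..n} :: nat \<Rightarrow> nat"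
  have compat: "?c1 (?r1 \<phi>) = ?c2 (?r2 \<phi>)" for \<phi> :: "nat \<Rightarrow> nat"
    using \<beta> g by (auto simp: restrict_def fun_eq_iff is_gluing_def)
  \<comment> \<open>The two embedded parts cover all vertices of the glued frame.\<close>
  have inj: "inj_on (\<lambda>\<phi>. (?r1 \<phi>, ?r2 \<phi>)) (Hom H G)" for G
  proof (rule inj_onI)
    fix \<phi> \<psi>
    assume *: "\<phi> \<in> Hom H G" "\<psi> \<in> Hom H G" and e: "(?r1 \<phi>, ?r2 \<phi>) = (?r1 \<psi>, ?r2 \<psi>)"
    show "\<phi> = \<psi>"
    proof (rule extensionalityI[of _ "verts H"])
      fix v assume "v \<in> verts H"
      moreover have "verts H = \<iota>1 ` verts H1 \<union> \<iota>2 ` verts H2"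
        using g by (simp add: is_gluing_def)
      ultimately consider x where "x \<in> verts H1" "v = \<iota>1 x" | x where "x \<in> verts H2" "v = \<iota>2 x"
        by blast
      then show "\<phi> v = \<psi> v"
      proof cases
        case 1
        then show ?thesis using fun_cong[OF arg_cong[OF e, of fst], of x] by simp
      next
        case 2
        then show ?thesis using fun_cong[OF arg_cong[OF e, of snd], of x] by simp
      qed
    qed (use * in \<open>auto simp: Hom_def PiE_iff\<close>)
  qed
  show ?thesis
  proof (rule that[OF g])
    fix G assume t: "target G"
    have fin: "finite (Hom H G)" and sub: "set_pmf (f G) \<subseteq> Hom H G"
      using s t by (auto intro!: finite_Hom simp: is_scheme_def target_def finite_simple_def)
    show "pull (verts H1) \<iota>1 f G = f1 G"
      unfolding pull_def
    proof (rule map_pmf_coupling_eq[where ?c1.0 = ?c1 and ?c2.0 = ?c2, OF fin sub inj])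
      show "map_pmf ?c1 (f1 G) = map_pmf ?c2 (f2 G)"
        using eq[OF t] by (simp only: pull_def)
    qed (use pmf[OF t] compat in \<open>simp_all only: pull_def\<close>)
    have inj': "inj_on (\<lambda>\<phi>. (?r2 \<phi>, ?r1 \<phi>)) (Hom H G)"
      using inj[of G] by (auto simp: inj_on_def)
    show "pull (verts H2) \<iota>2 f G = f2 G"
      unfolding pull_def
    proof (rule map_pmf_coupling_eq[where ?c1.0 = ?c2 and ?c2.0 = ?c1, OF fin sub inj'])
      show "map_pmf ?c2 (f2 G) = map_pmf ?c1 (f1 G)"
        using eq[OF t] by (simp only: pull_def)
      show "?c2 (?r2 \<phi>) = ?c1 (?r1 \<phi>)" for \<phi>
        by (rule compat[symmetric])
      \<comment> \<open>The formula is symmetric in the two parts, because the two overlap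
        distributions coincide and the overlap restrictions agree by \<open>compat\<close>.\<close>
      fix \<phi> assume "\<phi> \<in> Hom H G"
      then show "pmf (f G) \<phi> = pmf (f2 G) (?r2 \<phi>) * pmf (f1 G) (?r1 \<phi>)
          / pmf (map_pmf ?c2 (f2 G)) (?c2 (?r2 \<phi>))"
        using pmf[OF t, of \<phi>] eq[OF t] by (simp only: pull_def compat mult.commute)
    qed
  qed
qed

lemma entropy_marginal_embedding:
  assumes "pull T \<iota> f G = g G" "e \<subseteq> T"
  shows "entropy_pmf (marginal (\<iota> ` e) f G) = entropy_pmf (marginal e g G)"
  using pull_pull[where f = f and g = g and G = G and \<iota> = \<iota> and T = T and \<beta> = id and S = e] assms
    entropy_pull[of e \<iota> f G]
  by (simp add: marginal_def)

text \<open>Every edge of a glued frame is the image of an edge of a part, and the coupling keeps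
  that part's marginals. Tracking the entropy instead of the distribution makes the naming of the
  endpoints irrelevant.\<close>

lemma entropy_edge_marginal:
  assumes "coupling_structure H f" "e \<in> edges H" "target G"
  shows "entropy_pmf (marginal e f G) = ln (real (card (Hom edge_graph G)))"
  using assms
proof (induction arbitrary: e rule: coupling_structure.induct)
  case edge
  let ?u = "pmf_of_set (Hom edge_graph G)"
  have fin: "finite (Hom edge_graph G)" and ne: "Hom edge_graph G \<noteq> {}"
    using edge finite_Hom_edge_graph Hom_edge_graph_nonempty by blast+
  \<comment> \<open>The only edge is the whole vertex set, so restricting to it changes no
    homomorphism.\<close>
  have "map_pmf (\<lambda>\<phi>. restrict \<phi> {1, 2}) ?u = map_pmf (\<lambda>\<phi>. \<phi>) ?u"
    using fin ne by (intro map_pmf_cong refl)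
      (auto simp: Hom_def edge_graph_def PiE_def extensional_restrict)
  then have "marginal e (\<lambda>G. pmf_of_set (Hom edge_graph G)) G = ?u"
    using edge by (simp add: marginal_def pull_def edge_graph_def)
  then show ?case
    by (simp add: entropy_pmf_of_set fin ne)
next
  case (coupling H1 f1 H2 f2 n \<beta>1 \<beta>2 H f)
  have s: "is_scheme H1 f1" "is_scheme H2 f2"
    using coupling.hyps coupling_structure_is_scheme by blast+
  then obtain \<iota>1 \<iota>2 where g: "is_gluing H1 H2 n \<beta>1 \<beta>2 H \<iota>1 \<iota>2"
    and pull: "pull (verts H1) \<iota>1 f G = f1 G" "pull (verts H2) \<iota>2 f G = f2 G"
    using is_coupling_pull coupling.hyps coupling.prems by metis
  from g coupling.prems consider e' where "e' \<in> edges H1" "e = \<iota>1 ` e'"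
    | e' where "e' \<in> edges H2" "e = \<iota>2 ` e'"
    by (auto simp: is_gluing_def)
  then show ?case
  proof cases
    case 1
    then have "e' \<subseteq> verts H1"
      using s by (auto simp: is_scheme_def finite_simple_def)
    then show ?thesis
      using 1 coupling entropy_marginal_embedding[where f = f and g = f1 and \<iota> = \<iota>1, OF pull(1)] by simp
  next
    case 2
    then have "e' \<subseteq> verts H2"
      using s by (auto simp: is_scheme_def finite_simple_def)
    then show ?thesis
      using 2 coupling entropy_marginal_embedding[where f = f and g = f2 and \<iota> = \<iota>2, OF pull(2)] by simp
  qed
qed

section \<open>The entropy deficit as a linear functional\<close>

text \<open>For a scheme at a target and \<open>S\<close> inside the frame, this is the relative
  entropy of the marginal on \<open>S\<close> with respect to the uniform distribution on maps from
  \<open>S\<close> to \<open>verts G\<close>.\<close>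

definition deficit :: "scheme \<Rightarrow> sgraph \<Rightarrow> nat set \<Rightarrow> real" where
  "deficit f G S = real (card S) * ln (real (card (verts G))) - entropy_pmf (marginal S f G)"

text \<open>The linear extension of \<open>d\<close>. Summing over the fixed index set
  \<open>Pow V\<close>, not over the support of \<open>x\<close>, makes linearity immediate.\<close>

definition eval_on :: "nat set \<Rightarrow> (nat set \<Rightarrow> real) \<Rightarrow> setfun \<Rightarrow> real" where
  "eval_on V d x = (\<Sum>S\<in>Pow V. Poly_Mapping.lookup x S * d S)"

lemma lookup_scaleR: "Poly_Mapping.lookup (r *\<^sub>R x :: setfun) S = r * Poly_Mapping.lookup x S"
proof -
  have "finite {S. r *\<^sub>R Poly_Mapping.lookup x S \<noteq> 0}"
    by (rule finite_subset[OF _ finite_lookup[of x]]) auto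
  then show ?thesis
    by (simp add: scaleR_poly_mapping_def Abs_poly_mapping_inverse)
qed

lemma linear_eval_on: "linear (eval_on V d)"
  by (intro linearI)
    (auto simp: eval_on_def lookup_add lookup_scaleR algebra_simps sum.distrib sum_distrib_left)

lemma eval_on_unit_at:
  assumes "finite V" "S \<subseteq> V"
  shows "eval_on V d (unit_at S) = d S"
proof -
  have "eval_on V d (unit_at S) = (\<Sum>T\<in>Pow V. if S = T then d T else 0)"
    unfolding eval_on_def by (intro sum.cong) (auto simp: unit_at_def lookup_single when_def)
  then show ?thesis
    using assms by simp
qed

lemma linear_zero_on_span:
  assumes "linear F" "\<And>x. x \<in> B \<Longrightarrow> F x = 0" "x \<in> span B"
  shows "F x = (0 :: real)"
  using linear_eq_0_on_span[OF assms(1)] assms by blast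

text \<open>The half-space where \<open>F\<close> is nonnegative is itself a convex cone containing
  \<open>B\<close>.\<close>

lemma linear_nonneg_on_convex_cone_hull:
  assumes "linear F" "\<And>x. x \<in> B \<Longrightarrow> F x \<ge> 0" "x \<in> convex_cone hull B"
  shows "F x \<ge> (0 :: real)"
proof -
  have "convex_cone {x. F x \<ge> 0}"
    using linear_0[OF assms(1)]
    by (auto simp: convex_cone_iff linear_add[OF assms(1)] linear_scale[OF assms(1)])
  then have "convex_cone hull B \<subseteq> {x. F x \<ge> 0}"
    using assms(2) by (intro hull_minimal) auto
  then show ?thesis using assms(3) by blast
qed

section \<open>The deficit of a fixed scheme at a fixed target\<close>

context
  fixes H f G
  assumes scheme: "is_scheme H f" and target: "target G"
begin

lemma finite_set_marginal: "finite (set_pmf (marginal S f G))"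
  using is_scheme_finite_set_pmf[OF scheme target] by (simp add: marginal_def pull_def)

lemma deficit_empty: "deficit f G {} = 0"
  by (simp add: deficit_def marginal_def pull_def restrict_def entropy_pmf_def)

text \<open>There are \<open>card (verts G) ^ card S\<close> maps on \<open>S\<close>, and the
  entropy is at most the logarithm of this number.\<close>

lemma deficit_nonneg:
  assumes "S \<subseteq> verts H"
  shows "deficit f G S \<ge> 0"
proof -
  have fin: "finite (verts G)" "finite (verts H)" and "verts G \<noteq> {}"
    using target scheme by (auto simp: target_def finite_simple_def is_scheme_def)
  then have "card (verts G) > 0" "finite S"
    using assms by (auto simp: card_gt_0_iff intro: finite_subset)
  have "set_pmf (marginal S f G) \<subseteq> S \<rightarrow>\<^sub>E verts G"
    using set_marginal_subset_Hom[OF scheme target assms] by (auto simp: Hom_def induced_def)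
  then have "entropy_pmf (marginal S f G) \<le> ln (real (card (S \<rightarrow>\<^sub>E verts G)))"
    using \<open>finite S\<close> fin by (intro entropy_le_ln_card) (auto simp: finite_PiE)
  then show ?thesis
    using \<open>card (verts G) > 0\<close> \<open>finite S\<close> by (simp add: deficit_def card_PiE ln_realpow)
qed

text \<open>The cardinality term of the deficit is modular, so only the entropies matter in
  comparing unions and intersections.\<close>

lemma real_card_Un_Int:
  assumes "A \<subseteq> verts H" "B \<subseteq> verts H"
  shows "real (card (A \<union> B)) = real (card A) + real (card B) - real (card (A \<inter> B))"
proof -
  have "finite A" "finite B"
    using assms scheme by (auto simp: is_scheme_def finite_simple_def intro: finite_subset)
  then show ?thesis
    using card_Un_Int[of A B] by linarith
qed

lemma marginal_Un_parts:
  "marginal A f G = map_pmf (\<lambda>\<phi>. restrict \<phi> A) (marginal (A \<union> B) f G)"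
  "marginal B f G = map_pmf (\<lambda>\<phi>. restrict \<phi> B) (marginal (A \<union> B) f G)"
  "marginal (A \<inter> B) f G = map_pmf (\<lambda>\<phi>. restrict \<phi> (A \<inter> B)) (marginal (A \<union> B) f G)"
  by (intro marginal_marginal; blast)+

text \<open>A map on \<open>A \<union> B\<close> is determined by its restrictions to
  \<open>A\<close> and \<open>B\<close>, both of which determine its restriction to
  \<open>A \<inter> B\<close>; hence submodularity of entropy applies, and the minus sign reverses
  it.\<close>

lemma deficit_supermodular:
  assumes "A \<subseteq> verts H" "B \<subseteq> verts H"
  shows "deficit f G A + deficit f G B \<le> deficit f G (A \<union> B) + deficit f G (A \<inter> B)"
proof -
  have "inj_on (\<lambda>\<phi>. (restrict \<phi> A, restrict \<phi> B)) (set_pmf (marginal (A \<union> B) f G))"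
  proof (rule inj_onI)
    fix \<phi> \<psi>
    assume *: "\<phi> \<in> set_pmf (marginal (A \<union> B) f G)" "\<psi> \<in> set_pmf (marginal (A \<union> B) f G)"
      and "(restrict \<phi> A, restrict \<phi> B) = (restrict \<psi> A, restrict \<psi> B)"
    then have "restrict \<phi> A = restrict \<psi> A" "restrict \<phi> B = restrict \<psi> B" by auto
    then have "\<phi> x = \<psi> x" if "x \<in> A \<union> B" for x
      using that by (metis Un_iff restrict_apply')
    then show "\<phi> = \<psi>"
      using * by (intro extensionalityI[of _ "A \<union> B"]) (auto dest: set_marginal_extensional)
  qed
  then have "entropy_pmf (marginal (A \<union> B) f G) + entropy_pmf (marginal (A \<inter> B) f G)
      \<le> entropy_pmf (marginal A f G) + entropy_pmf (marginal B f G)"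
    unfolding marginal_Un_parts[where A = A and B = B]
    by (intro entropy_submodular[where ?c1.0 = "\<lambda>\<phi>. restrict \<phi> (A \<inter> B)"
          and ?c2.0 = "\<lambda>\<phi>. restrict \<phi> (A \<inter> B)"] finite_set_marginal)
      (auto simp: Int_commute Int_left_commute)
  then show ?thesis
    by (simp add: deficit_def real_card_Un_Int[OF assms] algebra_simps)
qed

lemma deficit_CI:
  assumes "(A, B) \<in> CI H f"
  shows "deficit f G (A \<union> B) + deficit f G (A \<inter> B) = deficit f G A + deficit f G B"
proof -
  have AB: "A \<subseteq> verts H" "B \<subseteq> verts H"
    using assms by (auto simp: CI_def)
  \<comment> \<open>The product formula in \<open>CI\<close> is quantified over these maps only, so
    the support must lie among them.\<close>
  have "set_pmf (marginal (A \<union> B) f G) \<subseteq> A \<union> B \<rightarrow>\<^sub>E verts G"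
    using set_marginal_subset_Hom[OF scheme target, of "A \<union> B"] AB by (auto simp: Hom_def induced_def)
  then have "pmf (marginal (A \<union> B) f G) \<phi> =
      pmf (marginal A f G) (restrict \<phi> A) * pmf (marginal B f G) (restrict \<phi> B)
        / pmf (marginal (A \<inter> B) f G) (restrict \<phi> (A \<inter> B))"
    if "\<phi> \<in> set_pmf (marginal (A \<union> B) f G)" for \<phi>
    using that assms target by (auto simp: CI_def)
  then have "entropy_pmf (marginal (A \<union> B) f G) + entropy_pmf (marginal (A \<inter> B) f G)
      = entropy_pmf (marginal A f G) + entropy_pmf (marginal B f G)"
    unfolding marginal_Un_parts[where A = A and B = B] by (intro entropy_modular finite_set_marginal)
  then show ?thesis
    by (simp add: deficit_def real_card_Un_Int[OF AB] algebra_simps)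
qed

lemma deficit_IS:
  assumes "(A, B) \<in> IS H f"
  shows "deficit f G A = deficit f G B"
proof -
  obtain \<beta> where \<beta>: "bij_betw \<beta> A B" "marginal A f G = pull A \<beta> f G"
    using assms target by (auto simp: IS_def)
  then show ?thesis
    using entropy_pull[of A \<beta> f G]
    by (simp add: deficit_def bij_betw_same_card bij_betw_imp_surj_on)
qed

lemma eval_on_deficit_nonneg:
  assumes "x \<in> C_space H f + I_space H f + Q_set (verts H)"
  shows "eval_on (verts H) (deficit f G) x \<ge> 0"
proof -
  let ?F = "eval_on (verts H) (deficit f G)"
  have fin: "finite (verts H)"
    using scheme by (simp add: is_scheme_def finite_simple_def)
  note unit = eval_on_unit_at[OF fin, of _ "deficit f G"]
  note lin = linear_eval_on[of "verts H" "deficit f G"]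
  have t: "?F (t_vec A B) = deficit f G (A \<union> B) - deficit f G A - deficit f G B + deficit f G (A \<inter> B)"
    if "A \<subseteq> verts H" "B \<subseteq> verts H" for A B
  proof -
    have "A \<union> B \<subseteq> verts H" "A \<inter> B \<subseteq> verts H" using that by auto
    then show ?thesis
      using that by (simp add: t_vec_def linear_add[OF lin] linear_diff[OF lin] unit)
  qed
  from assms obtain c i u k where x: "x = c + i + (u + k)"
    and c: "c \<in> C_space H f" and i: "i \<in> I_space H f" and u: "u \<in> span {unit_at {}}"
    and k: "k \<in> convex_cone hull
      ({t_vec A B |A B. A \<subseteq> verts H \<and> B \<subseteq> verts H} \<union> {unit_at A |A. A \<subseteq> verts H})"
    by (auto simp: Q_set_def elim!: set_plus_elim)
  have "?F c = 0"
  proof (rule linear_zero_on_span[OF lin _ c[unfolded C_space_def W_space_def]])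
    fix y assume "y \<in> {t_vec A B |A B. (A, B) \<in> CI H f}"
    then obtain A B where "y = t_vec A B" "(A, B) \<in> CI H f" by blast
    then show "?F y = 0"
      using deficit_CI[of A B] t[of A B] by (simp add: CI_def)
  qed
  moreover have "?F i = 0"
  proof (rule linear_zero_on_span[OF lin _ i[unfolded I_space_def]])
    fix y assume "y \<in> {unit_at A - unit_at B |A B. (A, B) \<in> IS H f}"
    then obtain A B where "y = unit_at A - unit_at B" "(A, B) \<in> IS H f" by blast
    then show "?F y = 0"
      using deficit_IS[of A B] by (simp add: IS_def linear_diff[OF lin] unit)
  qed
  \<comment> \<open>Multiples of \<open>unit_at {}\<close> come with either sign, so here the
    deficit must vanish exactly.\<close>
  moreover have "?F u = 0"
    by (rule linear_zero_on_span[OF lin _ u]) (auto simp: unit deficit_empty)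
  moreover have "?F k \<ge> 0"
  proof (rule linear_nonneg_on_convex_cone_hull[OF lin _ k])
    fix y
    assume "y \<in> {t_vec A B |A B. A \<subseteq> verts H \<and> B \<subseteq> verts H} \<union> {unit_at A |A. A \<subseteq> verts H}"
    then consider A B where "y = t_vec A B" "A \<subseteq> verts H" "B \<subseteq> verts H"
      | A where "y = unit_at A" "A \<subseteq> verts H" by blast
    then show "?F y \<ge> 0"
    proof cases
      case 1
      then show ?thesis
        using deficit_supermodular[of A B] t[of A B] by simp
    next
      case 2
      then show ?thesis
        using deficit_nonneg[of A] unit[of A] by simp
    qed
  qed
  ultimately show ?thesis
    by (simp add: x linear_add[OF lin])
qed

end

section \<open>Homomorphism densities\<close>

lemma hom_density_eq:
  assumes "finite (verts H)" "finite (verts G)" "verts G \<noteq> {}"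
  shows "hom_density H G = real (card (Hom H G)) / real (card (verts G)) ^ card (verts H)"
proof -
  have "(verts H \<rightarrow>\<^sub>E verts G) \<inter> Hom H G = Hom H G"
    by (auto simp: Hom_def)
  moreover have "(verts H \<rightarrow>\<^sub>E verts G) \<noteq> {}"
    using assms by (simp add: PiE_eq_empty_iff)
  ultimately show ?thesis
    using assms by (simp add: hom_density_def measure_pmf_of_set finite_PiE card_PiE)
qed

theorem theorem4p1:
  fixes H :: sgraph and f :: scheme and A :: "nat set"
  assumes "coupling_structure H f"
    and "A \<subseteq> verts H"
    and "s_vec H A \<in> C_space H f + I_space H f + Q_set (verts H)"
  shows "sidorenko (induced H A)"
  unfolding sidorenko_def
proof (intro allI impI)
  fix G assume G: "finite_simple G \<and> verts G \<noteq> {}"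
  have scheme: "is_scheme H f"
    using assms(1) by (rule coupling_structure_is_scheme)
  then have finH: "finite (verts H)" and edgesH: "\<And>e. e \<in> edges H \<Longrightarrow> e \<subseteq> verts H \<and> card e = 2"
    by (auto simp: is_scheme_def finite_simple_def)
  have finA: "finite A"
    using assms(2) finH finite_subset by blast
  let ?n = "real (card (verts G))" and ?E = "edges_in H A"
  have n: "?n > 0"
    using G by (auto simp: finite_simple_def card_gt_0_iff)
  have dA: "hom_density (induced H A) G = real (card (Hom (induced H A) G)) / ?n ^ card A"
    using G finA by (subst hom_density_eq) (auto simp: induced_def finite_simple_def)
  have de: "hom_density edge_graph G = real (card (Hom edge_graph G)) / ?n ^ 2"
    using G by (subst hom_density_eq) (auto simp: edge_graph_def finite_simple_def power2_eq_square)
  show "hom_density (induced H A) G \<ge> hom_density edge_graph G ^ card (edges (induced H A))"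
  proof (cases "edges G = {}")
    \<comment> \<open>An edgeless \<open>G\<close> is no target, so \<open>f G\<close> carries no
      information. Without edges in \<open>A\<close> both sides are 1; otherwise the right side is a
      positive power of 0.\<close>
    case True
    show ?thesis
    proof (cases "?E = {}")
      case True
      then have "Hom (induced H A) G = A \<rightarrow>\<^sub>E verts G"
        by (auto simp: Hom_def induced_def)
      then have "hom_density (induced H A) G = 1"
        using n finA by (simp add: dA card_PiE)
      then show ?thesis
        using True by (simp add: induced_def)
    next
      case False
      have "finite ?E"
        using finA by (auto simp: edges_in_def intro: finite_subset[of _ "Pow A"])
      then have "card ?E > 0"
        using False by (simp add: card_gt_0_iff)
      moreover have "Hom edge_graph G = {}"
        using True by (auto simp: Hom_def edge_graph_def)
      ultimately show ?thesis
        by (simp add: de induced_def hom_density_def zero_power)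
    qed
  next
    case False
    then have target: "target G"
      using G by (simp add: target_def)
    let ?F = "eval_on (verts H) (deficit f G)" and ?h = "real (card (Hom edge_graph G))"
      and ?k = "real (card (Hom (induced H A) G))"
    note lin = linear_eval_on[of "verts H" "deficit f G"]
    have h: "?h > 0"
      using finite_Hom_edge_graph[OF target] Hom_edge_graph_nonempty[OF target]
      by (simp add: card_gt_0_iff)
    have sub: "set_pmf (marginal A f G) \<subseteq> Hom (induced H A) G"
      by (rule set_marginal_subset_Hom[OF scheme target assms(2)])
    have fin: "finite (Hom (induced H A) G)"
      using finA G by (intro finite_Hom) (auto simp: induced_def finite_simple_def)
    \<comment> \<open>The support of a distribution is nonempty, so the density of the induced graph
      is positive and logarithms can be compared.\<close>
    have "Hom (induced H A) G \<noteq> {}"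
      using sub set_pmf_not_empty[of "marginal A f G"] by blast
    then have k: "?k > 0"
      using fin by (simp add: card_gt_0_iff)
    \<comment> \<open>An edge has two vertices, so its deficit is minus the logarithm of the edge
      density \<open>?h / ?n ^ 2\<close>.\<close>
    have "deficit f G e = 2 * ln ?n - ln ?h" if "e \<in> ?E" for e
      using that edgesH entropy_edge_marginal[OF assms(1) _ target, of e]
      by (auto simp: deficit_def edges_in_def)
    moreover have "?F (unit_at e) = deficit f G e" if "e \<in> ?E" for e
      using that edgesH by (intro eval_on_unit_at finH) (auto simp: edges_in_def)
    ultimately have "?F (s_vec H A) = - deficit f G A + real (card ?E) * (2 * ln ?n - ln ?h)"
      by (simp add: s_vec_def linear_diff[OF lin] linear_sum[OF lin] eval_on_unit_at[OF finH assms(2)])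
    then have "real (card ?E) * (ln ?h - 2 * ln ?n) \<le> - deficit f G A"
      using eval_on_deficit_nonneg[OF scheme target assms(3)] by (simp add: algebra_simps)
    also have "\<dots> \<le> ln ?k - real (card A) * ln ?n"
      using entropy_le_ln_card[OF fin sub] by (simp add: deficit_def)
    \<comment> \<open>The two sides are the logarithms of the densities to be compared, and
      \<open>ln\<close> is monotone on positive reals.\<close>
    finally have "ln ((?h / ?n ^ 2) ^ card ?E) \<le> ln (?k / ?n ^ card A)"
      using h k n by (simp add: ln_realpow ln_div)
    then show ?thesis
      unfolding dA de using h k n by (simp add: induced_def)
  qed
qed

end
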